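(* Let $\Gamma$ be a finitely generated infinite group, equipped with a word length metric. Then $[\Gamma]=0$ in $H_0^{\mathrm{lin}}(\Gamma)$.
   Context: $\Gamma$ carries the (left-invariant) word length metric $d$ of a finite symmetric generating set, with base point the identity $e$. For a tuple $\overline{x}=(x_0,\dots,x_n)\in \Gamma^{n+1}$ put $|\overline{x}|=\max_i d(x_i,e)$, and for tuples $d(\overline{x},\overline{y})=\max_i d(x_i,y_i)$. Let $f:[0,\infty)\to[0,\infty)$ be a non-decreasing function with $f(0)=1$ such that for every $K>0$ there is $L>0$ with $f(t+K)\le Lf(t)$ and $f(Kt)\le Lf(t)$ for all $t>0$. Let $C_n^f(\Gamma)$ be the real vector space of functions $c:\Gamma^{n+1}\to\mathbb{R}$ (also written as formal sums $\sum c_{\overline{x}}\,\overline{x}$ of simplices) that are alternating (a permutation of the vertices multiplies the value by its sign), have finite propagation (there is $R$ with $c_{\overline{x}}=0$ whenever $d(\overline{x},\Delta_{n+1})\ge R$, where $\Delta_{n+1}\subset \Gamma^{n+1}$ is the diagonal), and satisfy $|c_{\overline{x}}|\le K_c f(|\overline{x}|)$ for some constant $K_c$ depending on $c$. The differential $\partial:C_n^f\to C_{n-1}^f$ is the linear extension of $\partial[x_0,\dots,x_n]=\sum_i(-1)^i[x_0,\dots,\hat{x_i},\dots,x_n]$ (each simplex counted once up to reordering of its vertices); on functions, $(\partial c)(y_0,\dots,y_{n-1})=\sum_{z}c(z,y_0,\dots,y_{n-1})$, in particular $\partial\psi(x)=\sum_y\psi(y,x)$ for a $1$-chain $\psi$.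 $H_*^f(\Gamma)$ is the homology of this complex; $H_*^{\mathrm{lin}}(\Gamma)$ is $H_*^f(\Gamma)$ for $f$ linear, i.e. $f(t)=1+t$. The fundamental class $[\Gamma]\in H_0^f(\Gamma)$ is the class of $\sum_{x\in\Gamma}[x]$ (the constant function $1$). *)

theory Defs
  imports
    Complex_Main
    "HOL-Algebra.Generated_Groups"
    "HOL-Algebra.Coset"
    "HOL-Combinatorics.Permutations"
begin

section \<open>Word length metrics\<close>

definition symmetric_generating_set :: "('a, 'b) monoid_scheme \<Rightarrow> 'a set \<Rightarrow> bool" where
  "symmetric_generating_set G S \<longleftrightarrow>
     S \<subseteq> carrier G \<and> (\<forall>s\<in>S. inv\<^bsub>G\<^esub> s \<in> S) \<and> generate G S = carrier G"

definition word_length :: "('a, 'b) monoid_scheme \<Rightarrow> 'a set \<Rightarrow> 'a \<Rightarrow> nat" where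
  "word_length G S g =
     (LEAST n. \<exists>ws. set ws \<subseteq> S \<and> length ws = n \<and> foldr (\<otimes>\<^bsub>G\<^esub>) ws \<one>\<^bsub>G\<^esub> = g)"

definition word_dist :: "('a, 'b) monoid_scheme \<Rightarrow> 'a set \<Rightarrow> 'a \<Rightarrow> 'a \<Rightarrow> nat" where
  "word_dist G S x y = word_length G S (inv\<^bsub>G\<^esub> x \<otimes>\<^bsub>G\<^esub> y)"

text \<open>A simplex \<open>(x\<^sub>0, \<dots>, x\<^sub>n)\<close> is a list of length \<open>n + 1\<close> over the carrier.\<close>

definition simplices :: "('a, 'b) monoid_scheme \<Rightarrow> nat \<Rightarrow> 'a list set" where
  "simplices G n = {xs. length xs = Suc n \<and> set xs \<subseteq> carrier G}"

text \<open>The following two are meant for nonempty tuples, and for tuples of equal length.\<close>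

definition tuple_norm :: "('a, 'b) monoid_scheme \<Rightarrow> 'a set \<Rightarrow> 'a list \<Rightarrow> nat" where
  "tuple_norm G S xs = Max ((\<lambda>x. word_dist G S x \<one>\<^bsub>G\<^esub>) ` set xs)"

definition tuple_dist :: "('a, 'b) monoid_scheme \<Rightarrow> 'a set \<Rightarrow> 'a list \<Rightarrow> 'a list \<Rightarrow> nat" where
  "tuple_dist G S xs ys = Max ((\<lambda>i. word_dist G S (xs ! i) (ys ! i)) ` {..<length xs})"

definition diagonal_dist :: "('a, 'b) monoid_scheme \<Rightarrow> 'a set \<Rightarrow> 'a list \<Rightarrow> nat" where
  "diagonal_dist G S xs = (INF z\<in>carrier G. tuple_dist G S xs (replicate (length xs) z))"


section \<open>Uniformly finite homology with controlled growth\<close>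

text \<open>
  The admissible control functions; only the values on \<open>[0, \<infinity>)\<close> matter.  These conditions
  ensure that the boundary of a chain is again a chain; they are not part of the definitions
  below, which take an arbitrary \<open>f\<close>.
\<close>

definition growth_function :: "(real \<Rightarrow> real) \<Rightarrow> bool" where
  "growth_function f \<longleftrightarrow>
     (\<forall>t\<ge>0. f t \<ge> 0) \<and> mono_on {0..} f \<and> f 0 = 1 \<and>
     (\<forall>K>0. \<exists>L>0. \<forall>t>0. f (t + K) \<le> L * f t \<and> f (K * t) \<le> L * f t)"

definition linear_growth :: "real \<Rightarrow> real" where
  "linear_growth t = 1 + t"

lemma growth_function_linear: "growth_function linear_growth"
proof -
  have "\<exists>L>0. \<forall>t>0. linear_growth (t + K) \<le> L * linear_growth t \<and>
          linear_growth (K * t) \<le> L * linear_growth t" if "K > 0" for K :: real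
    using that by (intro exI[of _ "1 + K"]) (auto simp: linear_growth_def algebra_simps)
  then show ?thesis
    by (auto simp: growth_function_def linear_growth_def mono_on_def)
qed

text \<open>
  Chains are functions on all lists, so they are required to vanish off the simplices of the
  given degree.
\<close>

definition chains ::
    "('a, 'b) monoid_scheme \<Rightarrow> 'a set \<Rightarrow> (real \<Rightarrow> real) \<Rightarrow> nat \<Rightarrow> ('a list \<Rightarrow> real) set" where
  "chains G S f n =
     {c. (\<forall>xs. xs \<notin> simplices G n \<longrightarrow> c xs = 0) \<and>
         (\<forall>xs\<in>simplices G n. \<forall>\<pi>. \<pi> permutes {..<Suc n} \<longrightarrow>
            c (permute_list \<pi> xs) = of_int (sign \<pi>) * c xs) \<and>
         (\<exists>R::real. \<forall>xs\<in>simplices G n. real (diagonal_dist G S xs) \<ge> R \<longrightarrow> c xs = 0) \<and>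
         (\<exists>K::real. \<forall>xs\<in>simplices G n. \<bar>c xs\<bar> \<le> K * f (real (tuple_norm G S xs)))}"

text \<open>
  The differential from degree \<open>n\<close> to degree \<open>n - 1\<close>; it is zero in degree \<open>0\<close>.  By finite
  propagation, and since balls of a word metric are finite, the index set of the sum is finite
  when \<open>c\<close> is a chain.
\<close>

definition boundary ::
    "('a, 'b) monoid_scheme \<Rightarrow> nat \<Rightarrow> ('a list \<Rightarrow> real) \<Rightarrow> 'a list \<Rightarrow> real" where
  "boundary G n c ys =
     (if n > 0 \<and> ys \<in> simplices G (n - 1)
      then \<Sum>z | z \<in> carrier G \<and> c (z # ys) \<noteq> 0. c (z # ys) else 0)"

definition cycle_group ::
    "('a, 'b) monoid_scheme \<Rightarrow> 'a set \<Rightarrow> (real \<Rightarrow> real) \<Rightarrow> nat \<Rightarrow> ('a list \<Rightarrow> real) monoid" where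
  "cycle_group G S f n =
     \<lparr>carrier = {c \<in> chains G S f n. boundary G n c = (\<lambda>_. 0)},
      monoid.mult = (\<lambda>a b xs. a xs + b xs), one = (\<lambda>_. 0)\<rparr>"

definition boundaries ::
    "('a, 'b) monoid_scheme \<Rightarrow> 'a set \<Rightarrow> (real \<Rightarrow> real) \<Rightarrow> nat \<Rightarrow> ('a list \<Rightarrow> real) set" where
  "boundaries G S f n = boundary G (Suc n) ` chains G S f (Suc n)"

text \<open>
  Homology is recorded as the quotient of the additive groups underlying the real vector
  spaces of cycles and boundaries.
\<close>

definition homology ::
    "('a, 'b) monoid_scheme \<Rightarrow> 'a set \<Rightarrow> (real \<Rightarrow> real) \<Rightarrow> nat \<Rightarrow> ('a list \<Rightarrow> real) set monoid" where
  "homology G S f n = cycle_group G S f n Mod boundaries G S f n"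

definition homology_class ::
    "('a, 'b) monoid_scheme \<Rightarrow> 'a set \<Rightarrow> (real \<Rightarrow> real) \<Rightarrow> nat \<Rightarrow> ('a list \<Rightarrow> real)
      \<Rightarrow> ('a list \<Rightarrow> real) set" where
  "homology_class G S f n c = boundaries G S f n #>\<^bsub>cycle_group G S f n\<^esub> c"

definition fundamental_class ::
    "('a, 'b) monoid_scheme \<Rightarrow> 'a set \<Rightarrow> (real \<Rightarrow> real) \<Rightarrow> ('a list \<Rightarrow> real) set" where
  "fundamental_class G S f =
     homology_class G S f 0 (\<lambda>xs. if xs \<in> simplices G 0 then 1 else 0)"

end

theory Submission
  imports Defs "HOL-Library.Diagonal_Subsequence" "HOL-Library.Infinite_Set"
begin

text \<open>
  By compactness there is a bi-infinite geodesic through the identity; let \<open>p\<close> and \<open>q\<close> be its two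
  halves.  For every \<open>x\<close> the translates satisfy \<open>k + l = d(x p\<^sub>k, x q\<^sub>l) \<le> |x p\<^sub>k| + |x q\<^sub>l|\<close>, so one of
  them, call it \<open>r\<^sub>x\<close>, satisfies \<open>|r\<^sub>x(k)| \<ge> k\<close> for all \<open>k\<close>.  Send a unit of mass from each \<open>x\<close> to
  infinity along \<open>r\<^sub>x\<close>.  If \<open>r\<^sub>x(k) = y\<close>, then \<open>k \<le> |y|\<close>, and \<open>x\<close> is \<open>y p\<^sub>k\<^sup>-\<^sup>1\<close> or \<open>y q\<^sub>k\<^sup>-\<^sup>1\<close>; hence at
  most \<open>2 (|y| + 1)\<close> units pass through \<open>y\<close>.  The total flow is a chain of linear growth whose
  boundary is, up to sign, the constant function 1.
\<close>

section \<open>Word metrics\<close>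

text \<open>Only what makes \<open>d\<close> a metric is assumed here. Finiteness of
  \<open>S\<close> first enters through finite balls, infinitude of the group through long
  geodesics.\<close>

locale word_metric = group G for G (structure) +
  fixes S
  assumes symgen: "symmetric_generating_set G S"
begin

abbreviation "word_prod ws \<equiv> foldr (\<otimes>) ws \<one>"
abbreviation "len \<equiv> word_length G S"
abbreviation "d \<equiv> word_dist G S"

lemma gens_closed: "S \<subseteq> carrier G"
  and gens_inv: "s \<in> S \<Longrightarrow> inv s \<in> S"
  and gens_generate: "generate G S = carrier G"
  using symgen by (auto simp: symmetric_generating_set_def)

lemma word_prod_closed [simp]: "set ws \<subseteq> S \<Longrightarrow> word_prod ws \<in> carrier G"
  using gens_closed by (induction ws) auto

lemma word_prod_append:
  "set us \<subseteq> S \<Longrightarrow> set vs \<subseteq> S \<Longrightarrow> word_prod (us @ vs) = word_prod us \<otimes> word_prod vs"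
  using gens_closed by (induction us) (auto simp: m_assoc subset_iff)

lemma word_prod_inv:
  assumes "set ws \<subseteq> S"
  shows "word_prod (map (\<lambda>s. inv s) (rev ws)) = inv (word_prod ws)"
  using assms
proof (induction ws)
  case (Cons s ws)
  moreover have "s \<in> carrier G" "inv s \<in> S"
    using Cons.prems gens_closed gens_inv by auto
  moreover have "set (map (\<lambda>s. inv s) (rev ws)) \<subseteq> S"
    using Cons.prems gens_inv by auto
  ultimately show ?case
    by (simp add: word_prod_append inv_mult_group del: foldr_append)
qed auto

lemma ex_word:
  assumes "g \<in> carrier G"
  shows "\<exists>ws. set ws \<subseteq> S \<and> word_prod ws = g"
proof -
  have "g \<in> generate G S" using assms gens_generate by simp
  then show ?thesis
  proof (induction rule: generate.induct)
    case one
    then show ?case by (intro exI[of _ "[]"]) auto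
  next
    case (incl h)
    then show ?case using gens_closed by (intro exI[of _ "[h]"]) auto
  next
    \<comment> \<open>By symmetry of \<open>S\<close>, the inverse of a generator is itself a
      one-letter word.\<close>
    case (inv h)
    then show ?case using gens_closed gens_inv by (intro exI[of _ "[inv h]"]) auto
  next
    case (eng h1 h2)
    then obtain us vs where "set us \<subseteq> S" "word_prod us = h1" "set vs \<subseteq> S" "word_prod vs = h2"
      by blast
    then show ?case
      using word_prod_append[of us vs] by (intro exI[of _ "us @ vs"]) auto
  qed
qed

lemma len_word_prod_le: "set ws \<subseteq> S \<Longrightarrow> len (word_prod ws) \<le> length ws"
  unfolding word_length_def by (rule Least_le) blast

lemma geodesic_word:
  assumes "g \<in> carrier G"
  obtains ws where "set ws \<subseteq> S" "length ws = len g" "word_prod ws = g"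
proof -
  have "\<exists>n ws. set ws \<subseteq> S \<and> length ws = n \<and> word_prod ws = g"
    using ex_word[OF assms] by blast
  then have "\<exists>ws. set ws \<subseteq> S \<and> length ws = len g \<and> word_prod ws = g"
    unfolding word_length_def by (rule LeastI_ex)
  then show ?thesis using that by blast
qed

lemma len_mult:
  assumes "g \<in> carrier G" "h \<in> carrier G"
  shows "len (g \<otimes> h) \<le> len g + len h"
proof -
  obtain us vs where "set us \<subseteq> S" "length us = len g" "word_prod us = g"
      "set vs \<subseteq> S" "length vs = len h" "word_prod vs = h"
    using geodesic_word assms by metis
  then show ?thesis
    using len_word_prod_le[of "us @ vs"] word_prod_append[of us vs] by auto
qed

lemma len_inv_le:
  assumes "g \<in> carrier G"
  shows "len (inv g) \<le> len g"
proof -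
  obtain ws where ws: "set ws \<subseteq> S" "length ws = len g" "word_prod ws = g"
    using geodesic_word assms by metis
  have "set (map (\<lambda>s. inv s) (rev ws)) \<subseteq> S" using ws gens_inv by auto
  then show ?thesis
    using len_word_prod_le[of "map (\<lambda>s. inv s) (rev ws)"] word_prod_inv[of ws] ws by simp
qed

lemma len_one [simp]: "len \<one> = 0"
  using len_word_prod_le[of "[]"] by simp

section \<open>The left-invariant metric and its finite balls\<close>

lemma dist_self [simp]: "x \<in> carrier G \<Longrightarrow> d x x = 0"
  by (simp add: word_dist_def)

lemma dist_commute:
  assumes "x \<in> carrier G" "y \<in> carrier G"
  shows "d x y = d y x"
proof -
  have "d x y \<le> d y x" if "x \<in> carrier G" "y \<in> carrier G" for x y
    using len_inv_le[of "inv y \<otimes> x"] that by (simp add: word_dist_def inv_mult_group)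
  then show ?thesis using assms by (meson antisym)
qed

lemma dist_triangle:
  assumes "x \<in> carrier G" "y \<in> carrier G" "z \<in> carrier G"
  shows "d x z \<le> d x y + d y z"
proof -
  have "(inv x \<otimes> y) \<otimes> (inv y \<otimes> z) = inv x \<otimes> z"
    using assms by (metis inv_closed m_assoc m_closed inv_solve_left)
  then show ?thesis
    using len_mult[of "inv x \<otimes> y" "inv y \<otimes> z"] assms by (simp add: word_dist_def)
qed

lemma dist_mult_left:
  assumes "g \<in> carrier G" "x \<in> carrier G" "y \<in> carrier G"
  shows "d (g \<otimes> x) (g \<otimes> y) = d x y"
proof -
  have "inv (g \<otimes> x) \<otimes> (g \<otimes> y) = inv x \<otimes> y"
    using assms by (simp add: inv_mult_group m_assoc inv_solve_left')
  then show ?thesis by (simp add: word_dist_def)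
qed

lemma dist_one_left: "x \<in> carrier G \<Longrightarrow> d \<one> x = len x"
  by (simp add: word_dist_def)

text \<open>Each point of the ball is \<open>y\<close> times a geodesic word of length at most
  \<open>n\<close>, and a finite alphabet has finitely many such words.\<close>

lemma finite_ball:
  assumes "finite S" "y \<in> carrier G"
  shows "finite {x \<in> carrier G. d y x \<le> n}"
proof (rule finite_subset)
  show "finite ((\<lambda>ws. y \<otimes> word_prod ws) ` {ws. set ws \<subseteq> S \<and> length ws \<le> n})"
    using finite_lists_length_le[OF assms(1)] by simp
  show "{x \<in> carrier G. d y x \<le> n} \<subseteq>
      (\<lambda>ws. y \<otimes> word_prod ws) ` {ws. set ws \<subseteq> S \<and> length ws \<le> n}"
  proof
    fix x assume x: "x \<in> {x \<in> carrier G. d y x \<le> n}"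
    then have "inv y \<otimes> x \<in> carrier G" using assms by simp
    then obtain ws where "set ws \<subseteq> S" "length ws = d y x" "word_prod ws = inv y \<otimes> x"
      unfolding word_dist_def using geodesic_word by metis
    moreover have "x = y \<otimes> (inv y \<otimes> x)"
      using x assms by (metis (no_types, lifting) inv_closed inv_solve_left mem_Collect_eq m_closed)
    ultimately show "x \<in> (\<lambda>ws. y \<otimes> word_prod ws) ` {ws. set ws \<subseteq> S \<and> length ws \<le> n}"
      using x by (intro image_eqI[of _ _ ws]) auto
  qed
qed


section \<open>Bi-infinite geodesics\<close>

text \<open>Balls are finite, so some \<open>g\<close> has length above \<open>n\<close>. The
  prefixes of a geodesic word for \<open>g\<close> form the path.\<close>

lemma ex_finite_geodesic:
  assumes "finite S" "infinite (carrier G)"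
  obtains w where "\<And>i. w i \<in> carrier G" "\<And>i j. i \<le> j \<Longrightarrow> j \<le> n \<Longrightarrow> d (w i) (w j) = j - i"
proof -
  have "\<not> carrier G \<subseteq> {x \<in> carrier G. d \<one> x \<le> n}"
    using finite_ball[OF assms(1) one_closed] assms(2) finite_subset by blast
  then obtain g where "g \<in> carrier G" "\<not> d \<one> g \<le> n"
    by blast
  then have g: "g \<in> carrier G" "n < len g"
    by (simp_all add: dist_one_left)
  obtain ws where ws: "set ws \<subseteq> S" "length ws = len g" "word_prod ws = g"
    using geodesic_word g by metis
  define w where "w i = word_prod (take i ws)" for i
  have sub: "set (take i ws) \<subseteq> S" "set (drop i ws) \<subseteq> S" "set (take i (drop j ws)) \<subseteq> S" for i j
    using ws(1) by (meson set_take_subset set_drop_subset subset_trans)+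
  have w: "w i \<in> carrier G" for i using sub by (simp add: w_def)
  have up: "d (w i) (w j) \<le> j - i" if "i \<le> j" for i j
  proof -
    have "take j ws = take i ws @ take (j - i) (drop i ws)"
      using that by (metis le_add_diff_inverse take_add)
    then have "w j = w i \<otimes> word_prod (take (j - i) (drop i ws))"
      unfolding w_def using sub word_prod_append by metis
    then have "d (w i) (w j) = len (word_prod (take (j - i) (drop i ws)))"
      using w sub dist_mult_left[of "w i" \<one>] dist_one_left by (metis one_closed r_one word_prod_closed)
    also have "\<dots> \<le> j - i"
      using len_word_prod_le[OF sub(3), of "j - i" i] by simp
    finally show ?thesis .
  qed
  have ends: "w 0 = \<one>" "w (len g) = g" using ws by (simp_all add: w_def)
  \<comment> \<open>A shortcut between \<open>w i\<close> and \<open>w j\<close> would shorten the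
    whole path from the identity to \<open>g\<close>, so the upper bound \<open>up\<close> is an
    equality.\<close>
  have "d (w i) (w j) = j - i" if ij: "i \<le> j" "j \<le> n" for i j
  proof -
    have "len g = d (w 0) (w (len g))" using ends g dist_one_left by simp
    also have "\<dots> \<le> d (w 0) (w i) + (d (w i) (w j) + d (w j) (w (len g)))"
      using dist_triangle[OF w w w] by (meson add_left_mono order_trans)
    also have "\<dots> \<le> i + (d (w i) (w j) + (len g - j))"
      using up[of 0 i] up[of j "len g"] ij g by simp
    finally show ?thesis using up[OF ij(1)] ij g by simp
  qed
  with w that show ?thesis by blast
qed

end

text \<open>Sequential compactness of a product of finite sets, by Cantor's diagonal argument. The
  limit \<open>g\<close> is matched on every initial segment by some arbitrarily late
  \<open>f n\<close>.\<close>

lemma diagonal_constant_subsequence: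
  fixes f :: "nat \<Rightarrow> nat \<Rightarrow> 'c"
  assumes "\<And>k. finite (range (\<lambda>n. f n k))"
  obtains g where "\<And>m. \<exists>n\<ge>m. \<forall>k\<le>m. f n k = g k"
proof -
  \<comment> \<open>The property to be extracted at stage \<open>k\<close> is that coordinate
    \<open>k\<close> is constant along the subsequence.\<close>
  interpret subseqs "\<lambda>k s. \<exists>c. \<forall>n. f (s n) k = c"
  proof
    fix k and s :: "nat \<Rightarrow> nat"
    assume "strict_mono s"
    have "finite (range (\<lambda>n. f (s n) k))"
      by (rule finite_subset[OF _ assms[of k]]) auto
    then obtain n0 where "infinite {n. f (s n) k = f (s n0) k}"
      using pigeonhole_infinite[of UNIV "\<lambda>n. f (s n) k"] by auto
    from infinite_enumerate[OF this] obtain r :: "nat \<Rightarrow> nat"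
      where "strict_mono r" "\<forall>n. f (s (r n)) k = f (s n0) k"
      by auto
    then show "\<exists>r::nat \<Rightarrow> nat. strict_mono r \<and> (\<exists>c. \<forall>n. f ((s \<circ> r) n) k = c)"
      by (intro exI[of _ r]) auto
  qed
  \<comment> \<open>Beyond index \<open>k\<close> the diagonal sequence is a subsequence of the one
    extracted at stage \<open>k\<close>.\<close>
  have "\<exists>c. \<forall>n>k. f (diagseq n) k = c" for k
  proof -
    have "\<exists>c. \<forall>n. f ((diagseq \<circ> (+) (Suc k)) n) k = c"
      by (rule diagseq_holds) (auto simp: o_def)
    then obtain c where c: "\<And>n. f (diagseq (Suc k + n)) k = c"
      by auto
    have "f (diagseq n) k = c" if "n > k" for n
      using c[of "n - Suc k"] that by simp
    then show ?thesis by blast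
  qed
  then obtain g where g: "\<And>k n. n > k \<Longrightarrow> f (diagseq n) k = g k" by metis
  have "\<exists>n\<ge>m. \<forall>k\<le>m. f n k = g k" for m
  proof (intro exI conjI allI impI)
    \<comment> \<open>The witness is \<open>diagseq (Suc m)\<close>: its index exceeds every
      \<open>k <= m\<close>, as the strict bound in \<open>g\<close> demands.\<close>
    have "Suc m \<le> diagseq (Suc m)"
      using subseq_diagseq strict_mono_imp_increasing by blast
    then show "diagseq (Suc m) \<ge> m" by simp
  qed (use g in auto)
  then show ?thesis using that by blast
qed

section \<open>Limits of geodesics and rays escaping to infinity\<close>

context word_metric
begin

text \<open>Geodesics of length \<open>2 * n\<close> are translated to have their midpoint at the
  identity, and a limit is taken by compactness. \<open>p\<close> is the forward half and
  \<open>q\<close> the backward half.\<close>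

lemma ex_bi_infinite_geodesic:
  assumes "finite S" "infinite (carrier G)"
  obtains p q where "p 0 = \<one>" "q 0 = \<one>" "\<And>k. p k \<in> carrier G" "\<And>k. q k \<in> carrier G"
    "\<And>k. d (p k) (p (Suc k)) = 1" "\<And>k. d (q k) (q (Suc k)) = 1"
    "\<And>k l. d (p k) (q l) = k + l"
proof -
  have "\<forall>n. \<exists>w. (\<forall>i. w i \<in> carrier G) \<and> (\<forall>i j. i \<le> j \<longrightarrow> j \<le> 2 * n \<longrightarrow> d (w i) (w j) = j - i)"
  proof
    fix n
    obtain w where "\<And>i. w i \<in> carrier G" "\<And>i j. i \<le> j \<Longrightarrow> j \<le> 2 * n \<Longrightarrow> d (w i) (w j) = j - i"
      using ex_finite_geodesic[OF assms, of "2 * n"] by blast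
    then show "\<exists>w. (\<forall>i. w i \<in> carrier G) \<and> (\<forall>i j. i \<le> j \<longrightarrow> j \<le> 2 * n \<longrightarrow> d (w i) (w j) = j - i)"
      by (intro exI[of _ w]) simp
  qed
  from choice[OF this] obtain w where w: "\<And>n i. w n i \<in> carrier G"
      "\<And>n i j. i \<le> j \<Longrightarrow> j \<le> 2 * n \<Longrightarrow> d (w n i) (w n j) = j - i"
    by blast
  \<comment> \<open>Both halves are recorded at distance \<open>k\<close> from the midpoint. The
    default value beyond the ends keeps \<open>f n k\<close> in a product of balls of radius
    \<open>k\<close>, uniformly in \<open>n\<close>.\<close>
  define f where "f n k = (if k \<le> n
      then (inv (w n n) \<otimes> w n (n + k), inv (w n n) \<otimes> w n (n - k)) else (\<one>, \<one>))" for n k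
  let ?B = "\<lambda>k. {x \<in> carrier G. d \<one> x \<le> k}"
  have "f n k \<in> ?B k \<times> ?B k" for n k
    using w(2)[of n "n + k" n] w(2)[of "n - k" n n] dist_commute[OF w(1) w(1), of n "n - k" n n] w(1)
    by (auto simp: f_def dist_one_left word_dist_def)
  then have "range (\<lambda>n. f n k) \<subseteq> ?B k \<times> ?B k" for k by blast
  then have "finite (range (\<lambda>n. f n k))" for k
    by (rule finite_subset) (intro finite_cartesian_product finite_ball assms one_closed)
  then obtain g where g: "\<And>m. \<exists>n\<ge>m. \<forall>k\<le>m. f n k = g k"
    using diagonal_constant_subsequence[of f] by metis
  define p where "p = fst \<circ> g"
  define q where "q = snd \<circ> g"
  \<comment> \<open>Each required property involves finitely many indices, so it can be read off a
    single centred finite geodesic that agrees with \<open>p\<close> and \<open>q\<close>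
    there.\<close>
  have pq: "\<exists>n\<ge>m. \<forall>k\<le>m. p k = inv (w n n) \<otimes> w n (n + k) \<and> q k = inv (w n n) \<otimes> w n (n - k)" for m
  proof -
    obtain n where n: "n \<ge> m" "\<And>k. k \<le> m \<Longrightarrow> f n k = g k" using g[of m] by blast
    have "p k = inv (w n n) \<otimes> w n (n + k) \<and> q k = inv (w n n) \<otimes> w n (n - k)" if "k \<le> m" for k
      using n(2)[OF that, symmetric] n(1) that by (simp add: p_def q_def f_def)
    then show ?thesis using n(1) by blast
  qed
  have dw: "d (inv (w n n) \<otimes> w n i) (inv (w n n) \<otimes> w n j) = d (w n i) (w n j)" for n i j
    using w(1) dist_mult_left by simp
  show ?thesis
  proof
    show "p 0 = \<one>" "q 0 = \<one>" using pq[of 0] w(1) by auto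
    show "p k \<in> carrier G" "q k \<in> carrier G" for k using pq[of k] w(1) by auto
    show "d (p k) (p (Suc k)) = 1" for k
    proof -
      obtain n where n: "n \<ge> Suc k" "\<And>i. i \<le> Suc k \<Longrightarrow> p i = inv (w n n) \<otimes> w n (n + i)"
        using pq[of "Suc k"] by blast
      then show ?thesis using w(2)[of "n + k" "n + Suc k" n] dw by simp
    qed
    show "d (q k) (q (Suc k)) = 1" for k
    proof -
      obtain n where n: "n \<ge> Suc k" "\<And>i. i \<le> Suc k \<Longrightarrow> q i = inv (w n n) \<otimes> w n (n - i)"
        using pq[of "Suc k"] by blast
      then show ?thesis
        using w(2)[of "n - Suc k" "n - k" n] dw dist_commute[OF w(1) w(1), of n "n - k" n "n - Suc k"]
        by simp
    qed
    show "d (p k) (q l) = k + l" for k l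
    proof -
      \<comment> \<open>On this geodesic \<open>p k\<close> and \<open>q l\<close> sit at positions
        \<open>n + k\<close> and \<open>n - l\<close>.\<close>
      obtain n where n: "n \<ge> max k l"
          "\<And>i. i \<le> max k l \<Longrightarrow> p i = inv (w n n) \<otimes> w n (n + i) \<and> q i = inv (w n n) \<otimes> w n (n - i)"
        using pq[of "max k l"] by blast
      then show ?thesis
        using w(2)[of "n - l" "n + k" n] dw dist_commute[OF w(1) w(1), of n "n + k" n "n - l"]
        by simp
    qed
  qed
qed

lemma ex_escaping_rays:
  assumes "finite S" "infinite (carrier G)"
  shows "\<exists>r. (\<forall>x\<in>carrier G. r x 0 = x \<and> (\<forall>k. r x k \<in> carrier G \<and> d (r x k) (r x (Suc k)) = 1)) \<and>
    (\<forall>y\<in>carrier G. finite {(x, k). x \<in> carrier G \<and> r x k = y} \<and>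
      card {(x, k). x \<in> carrier G \<and> r x k = y} \<le> 2 * (1 + d y \<one>))"
proof -
  obtain p q where pq: "p 0 = \<one>" "q 0 = \<one>" "\<And>k. p k \<in> carrier G" "\<And>k. q k \<in> carrier G"
    "\<And>k. d (p k) (p (Suc k)) = 1" "\<And>k. d (q k) (q (Suc k)) = 1"
    "\<And>k l. d (p k) (q l) = k + l"
    using ex_bi_infinite_geodesic[OF assms] by metis
  \<comment> \<open>The choice between the two halves depends on \<open>x\<close> but not on
    \<open>k\<close>, so each \<open>r x\<close> is a translate of a whole half.\<close>
  define r where "r x k = x \<otimes> (if \<forall>j. j \<le> d (x \<otimes> p j) \<one> then p k else q k)" for x k
  have far: "k \<le> d (r x k) \<one>" if x: "x \<in> carrier G" for x k
  proof (cases "\<forall>j. j \<le> d (x \<otimes> p j) \<one>")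
    case True
    then show ?thesis by (simp add: r_def)
  next
    case False
    then obtain j where j: "d (x \<otimes> p j) \<one> < j" by (auto simp: not_le)
    \<comment> \<open>One index \<open>j\<close> where the \<open>p\<close> translate comes too
      close to the identity forces the \<open>q\<close> translate to be far at every
      \<open>k\<close>.\<close>
    have "j + k = d (x \<otimes> p j) (x \<otimes> q k)"
      using x pq dist_mult_left by simp
    also have "\<dots> \<le> d (x \<otimes> p j) \<one> + d \<one> (x \<otimes> q k)"
      using x pq by (intro dist_triangle) auto
    also have "d \<one> (x \<otimes> q k) = d (r x k) \<one>"
      using x pq False dist_commute[of \<one> "x \<otimes> q k"] by (auto simp: r_def)
    finally show ?thesis using j by simp
  qed
  \<comment> \<open>A passage through \<open>y\<close> is determined by its half and its time
    \<open>k\<close>, and \<open>far\<close> gives \<open>k <= d y \<one>\<close>. This leaves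
    \<open>2 * (1 + d y \<one>)\<close> possibilities.\<close>
  have sub: "{(x, k). x \<in> carrier G \<and> r x k = y} \<subseteq>
      (\<lambda>(b, k). (y \<otimes> inv (if b then p k else q k), k)) ` (UNIV \<times> {..d y \<one>})"
    if y: "y \<in> carrier G" for y
  proof clarify
    fix x k assume x: "x \<in> carrier G" "y = r x k"
    let ?b = "\<forall>j. j \<le> d (x \<otimes> p j) \<one>"
    have "x = y \<otimes> inv (if ?b then p k else q k)"
      using x pq by (simp add: r_def m_assoc)
    then show "(x, k) \<in> (\<lambda>(b, k'). (r x k \<otimes> inv (if b then p k' else q k'), k')) ` (UNIV \<times> {..d (r x k) \<one>})"
      using far[OF x(1), of k] x(2) by (intro image_eqI[of _ _ "(?b, k)"]) auto
  qed
  have fin: "finite (UNIV \<times> {..d y \<one>} :: (bool \<times> nat) set)" for y by simp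
  show ?thesis
  proof (intro exI[of _ r] conjI ballI allI)
    show "r x 0 = x" if "x \<in> carrier G" for x using that pq by (simp add: r_def)
    show "r x k \<in> carrier G" if "x \<in> carrier G" for x k using that pq by (simp add: r_def)
    show "d (r x k) (r x (Suc k)) = 1" if "x \<in> carrier G" for x k
      using that pq dist_mult_left by (simp add: r_def)
    fix y assume y: "y \<in> carrier G"
    show "finite {(x, k). x \<in> carrier G \<and> r x k = y}"
      using sub[OF y] fin finite_subset by blast
    have "card {(x, k). x \<in> carrier G \<and> r x k = y} \<le> card (UNIV \<times> {..d y \<one>} :: (bool \<times> nat) set)"
      using surj_card_le[OF fin sub[OF y]] .
    then show "card {(x, k). x \<in> carrier G \<and> r x k = y} \<le> 2 * (1 + d y \<one>)"
      by (simp add: card_cartesian_product)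
  qed
qed


section \<open>Chains and boundaries\<close>

lemma simplices_0: "ys \<in> simplices G 0 \<longleftrightarrow> (\<exists>y\<in>carrier G. ys = [y])"
  by (auto simp: simplices_def length_Suc_conv)

lemma simplices_1: "xs \<in> simplices G (Suc 0) \<longleftrightarrow> (\<exists>u\<in>carrier G. \<exists>v\<in>carrier G. xs = [u, v])"
  by (auto simp: simplices_def length_Suc_conv)

text \<open>Comparison with the diagonal point at \<open>v\<close>; it turns the unit step length of
  the flow into finite propagation.\<close>

lemma diagonal_dist_pair_le:
  assumes "u \<in> carrier G" "v \<in> carrier G"
  shows "diagonal_dist G S [u, v] \<le> d u v"
proof -
  have "diagonal_dist G S [u, v] \<le> tuple_dist G S [u, v] (replicate (length [u, v]) v)"
    unfolding diagonal_dist_def using assms by (intro cINF_lower) auto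
  also have "\<dots> = d u v"
    using assms by (simp add: tuple_dist_def lessThan_Suc insert_commute)
  finally show ?thesis .
qed

text \<open>An infimum of naturals is attained, so a nearest diagonal point \<open>z\<close> exists,
  and any two vertices are joined through it.\<close>

lemma dist_le_diagonal_dist:
  assumes "set xs \<subseteq> carrier G" "i < length xs" "j < length xs"
  shows "d (xs ! i) (xs ! j) \<le> 2 * diagonal_dist G S xs"
proof -
  have "diagonal_dist G S xs \<in> (\<lambda>z. tuple_dist G S xs (replicate (length xs) z)) ` carrier G"
    unfolding diagonal_dist_def by (rule Inf_nat_def1) (use one_closed in blast)
  then obtain z where z: "z \<in> carrier G"
      "diagonal_dist G S xs = tuple_dist G S xs (replicate (length xs) z)"
    by blast
  have le: "d (xs ! i) z \<le> diagonal_dist G S xs" if "i < length xs" for i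
  proof -
    have "d (xs ! i) (replicate (length xs) z ! i) \<le> tuple_dist G S xs (replicate (length xs) z)"
      unfolding tuple_dist_def by (rule Max_ge) (use that in auto)
    then show ?thesis using z that by simp
  qed
  have "xs ! i \<in> carrier G" "xs ! j \<in> carrier G" using assms nth_mem by blast+
  then show ?thesis
    using dist_triangle[of "xs ! i" z "xs ! j"] dist_commute[of "xs ! j" z] z le assms(2,3)
    by (smt (verit, best) add_mono mult_2 order_trans)
qed

text \<open>Makes the sum in \<open>boundary\<close> finite: finite propagation confines
  \<open>z\<close> to a ball around the first vertex of \<open>ys\<close>.\<close>

lemma finite_cofaces:
  assumes "finite S" "c \<in> chains G S f (Suc n)" "ys \<in> simplices G n"
  shows "finite {z \<in> carrier G. c (z # ys) \<noteq> 0}"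
proof -
  obtain R where R: "\<And>xs. xs \<in> simplices G (Suc n) \<Longrightarrow> real (diagonal_dist G S xs) \<ge> R \<Longrightarrow> c xs = 0"
    using assms(2) unfolding chains_def by blast
  have ys: "length ys = Suc n" "set ys \<subseteq> carrier G" "ys ! 0 \<in> carrier G"
    using assms(3) nth_mem[of 0 ys] by (auto simp: simplices_def)
  have "{z \<in> carrier G. c (z # ys) \<noteq> 0} \<subseteq> {z \<in> carrier G. d (ys ! 0) z \<le> 2 * nat \<lceil>R\<rceil>}"
  proof clarify
    fix z assume z: "z \<in> carrier G" "c (z # ys) \<noteq> 0"
    then have "z # ys \<in> simplices G (Suc n)" using ys by (simp add: simplices_def)
    then have "diagonal_dist G S (z # ys) \<le> nat \<lceil>R\<rceil>"
      using R z by (meson le_cases of_nat_ceiling order_trans of_nat_le_iff not_le)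
    moreover have "d (ys ! 0) z \<le> 2 * diagonal_dist G S (z # ys)"
      using dist_le_diagonal_dist[of "z # ys" 1 0] ys z by simp
    ultimately show "d (ys ! 0) z \<le> 2 * nat \<lceil>R\<rceil>" by simp
  qed
  then show ?thesis using finite_ball[OF assms(1) ys(3)] finite_subset by blast
qed

section \<open>Additivity of the boundary and the zero class in homology\<close>

lemma boundary_add:
  assumes "finite S" "b \<in> chains G S f (Suc n)" "c \<in> chains G S f (Suc n)"
  shows "boundary G (Suc n) (\<lambda>xs. b xs + c xs) = (\<lambda>ys. boundary G (Suc n) b ys + boundary G (Suc n) c ys)"
proof
  fix ys
  show "boundary G (Suc n) (\<lambda>xs. b xs + c xs) ys = boundary G (Suc n) b ys + boundary G (Suc n) c ys"
  proof (cases "ys \<in> simplices G n")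
    case True
    \<comment> \<open>The three sums range over different supports; all are extended by zeros to
      this common finite set.\<close>
    let ?Z = "{z \<in> carrier G. b (z # ys) \<noteq> 0} \<union> {z \<in> carrier G. c (z # ys) \<noteq> 0}"
    have Z: "finite ?Z" using finite_cofaces assms True by blast
    have bd: "boundary G (Suc n) e ys = (\<Sum>z\<in>?Z. e (z # ys))"
      if "{z \<in> carrier G. e (z # ys) \<noteq> 0} \<subseteq> ?Z" for e
      using True by (auto simp: boundary_def intro!: sum.mono_neutral_left[OF Z that])
    show ?thesis by (subst (1 2 3) bd) (auto simp: sum.distrib)
  qed (simp add: boundary_def)
qed

lemma boundary_uminus: "boundary G n (\<lambda>xs. - c xs) = (\<lambda>ys. - boundary G n c ys)"
  by (auto simp: boundary_def sum_negf)

lemma chains_add: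
  assumes "b \<in> chains G S f n" "c \<in> chains G S f n"
  shows "(\<lambda>xs. b xs + c xs) \<in> chains G S f n"
proof -
  obtain R where R: "\<And>xs. xs \<in> simplices G n \<Longrightarrow> real (diagonal_dist G S xs) \<ge> R \<Longrightarrow> b xs = 0"
    using assms(1) unfolding chains_def by blast
  obtain R' where R': "\<And>xs. xs \<in> simplices G n \<Longrightarrow> real (diagonal_dist G S xs) \<ge> R' \<Longrightarrow> c xs = 0"
    using assms(2) unfolding chains_def by blast
  obtain K where K: "\<And>xs. xs \<in> simplices G n \<Longrightarrow> \<bar>b xs\<bar> \<le> K * f (real (tuple_norm G S xs))"
    using assms(1) unfolding chains_def by blast
  obtain K' where K': "\<And>xs. xs \<in> simplices G n \<Longrightarrow> \<bar>c xs\<bar> \<le> K' * f (real (tuple_norm G S xs))"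
    using assms(2) unfolding chains_def by blast
  have "\<forall>xs\<in>simplices G n. real (diagonal_dist G S xs) \<ge> max R R' \<longrightarrow> b xs + c xs = 0"
    using R R' by simp
  moreover have "\<forall>xs\<in>simplices G n. \<bar>b xs + c xs\<bar> \<le> (K + K') * f (real (tuple_norm G S xs))"
    using K K' by (auto simp: distrib_right intro!: order_trans[OF abs_triangle_ineq] add_mono)
  moreover have "\<forall>xs. xs \<notin> simplices G n \<longrightarrow> b xs + c xs = 0"
    "\<forall>xs\<in>simplices G n. \<forall>\<pi>. \<pi> permutes {..<Suc n} \<longrightarrow>
       b (permute_list \<pi> xs) + c (permute_list \<pi> xs) = of_int (sign \<pi>) * (b xs + c xs)"
    using assms by (auto simp: chains_def distrib_left)
  ultimately show ?thesis unfolding chains_def by blast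
qed

lemma chains_uminus: "c \<in> chains G S f n \<Longrightarrow> (\<lambda>xs. - c xs) \<in> chains G S f n"
  by (simp add: chains_def)

text \<open>The unit of the quotient is the set of boundaries itself. Translating this set by
  \<open>c\<close> preserves it, since it is closed under sums and negatives.\<close>

lemma homology_class_eq_one:
  assumes "finite S" "c \<in> boundaries G S f n"
  shows "homology_class G S f n c = \<one>\<^bsub>homology G S f n\<^esub>"
proof -
  obtain b where b: "c = boundary G (Suc n) b" "b \<in> chains G S f (Suc n)"
    using assms(2) unfolding boundaries_def by (rule imageE)
  have add: "(\<lambda>xs. a xs + e xs) \<in> boundaries G S f n"
    if ae: "a \<in> boundaries G S f n" "e \<in> boundaries G S f n" for a e
  proof -
    obtain a' where a': "a = boundary G (Suc n) a'" "a' \<in> chains G S f (Suc n)"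
      using ae(1) unfolding boundaries_def by (rule imageE)
    obtain e' where e': "e = boundary G (Suc n) e'" "e' \<in> chains G S f (Suc n)"
      using ae(2) unfolding boundaries_def by (rule imageE)
    show ?thesis
      unfolding boundaries_def a'(1) e'(1) boundary_add[OF assms(1) a'(2) e'(2), symmetric]
      using chains_add[OF a'(2) e'(2)] by (rule imageI)
  qed
  have "(\<lambda>xs. - c xs) \<in> boundaries G S f n"
    unfolding boundaries_def b(1) boundary_uminus[symmetric]
    using chains_uminus[OF b(2)] by (rule imageI)
  then have "\<exists>e\<in>boundaries G S f n. a = (\<lambda>xs. e xs + c xs)" if "a \<in> boundaries G S f n" for a
    using add[OF that] by (intro bexI[of _ "\<lambda>xs. a xs + - c xs"]) (auto simp del: add_uminus_conv_diff)
  then show ?thesis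
    using add assms(2)
    by (auto simp: homology_class_def homology_def FactGroup_def r_coset_def cycle_group_def)
qed


section \<open>The chain of the flow\<close>

lemma constant_one_boundary:
  assumes "finite S" "infinite (carrier G)"
  shows "(\<lambda>xs. if xs \<in> simplices G 0 then 1 else 0) \<in> boundaries G S linear_growth 0"
proof -
  obtain r where r: "\<forall>x\<in>carrier G. r x 0 = x \<and> (\<forall>k. r x k \<in> carrier G \<and> d (r x k) (r x (Suc k)) = 1)"
    and passing: "\<forall>y\<in>carrier G. finite {(x, k). x \<in> carrier G \<and> r x k = y} \<and>
      card {(x, k). x \<in> carrier G \<and> r x k = y} \<le> 2 * (1 + d y \<one>)"
    using ex_escaping_rays[OF assms] by (elim exE conjE)
  have r0: "r x 0 = x" and rc: "r x k \<in> carrier G" and rs: "d (r x k) (r x (Suc k)) = 1"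
    if "x \<in> carrier G" for x k
    using r that by auto
  \<comment> \<open>\<open>T y\<close> lists the passages through \<open>y\<close> as pairs of
    starting point and time; \<open>E u v\<close> lists those that step next from \<open>u\<close>
    to \<open>v\<close>.\<close>
  define T where "T y = {(x, k). x \<in> carrier G \<and> r x k = y}" for y
  define E where "E u v = {(x, k). x \<in> carrier G \<and> r x k = u \<and> r x (Suc k) = v}" for u v
  have finT: "finite (T y)" and cardT: "card (T y) \<le> 2 * (1 + d y \<one>)" if "y \<in> carrier G" for y
    using passing that by (auto simp: T_def)
  have ET: "E u v \<subseteq> T u" for u v by (auto simp: E_def T_def)
  have finE: "finite (E u v)" if "u \<in> carrier G" for u v
    using finite_subset[OF ET finT[OF that]] .
  have E_disjoint: "E u v \<inter> E u' v' = {}" if "(u, v) \<noteq> (u', v')" for u v u' v'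
    using that by (auto simp: E_def)
  have E_far: "E u v = {}" if "d u v \<noteq> 1" for u v
    using rs that by (auto simp: E_def)
  have cardE: "real (card (E u v)) \<le> 2 * (1 + real (d u \<one>))" if "u \<in> carrier G" for u v
  proof -
    have "card (E u v) \<le> 2 * (1 + d u \<one>)"
      using cardT[OF that] card_mono[OF finT[OF that] ET[of u v]] by linarith
    then have "real (card (E u v)) \<le> real (2 * (1 + d u \<one>))" by (simp only: of_nat_le_iff)
    then show ?thesis by simp
  qed
  \<comment> \<open>The difference makes the chain alternating. A unit moving from \<open>u\<close>
    to \<open>v\<close> counts negatively in \<open>\<psi> [u, v]\<close>, so the boundary at
    \<open>y\<close> is outflow minus inflow.\<close>
  define \<psi> where "\<psi> xs = (if xs \<in> simplices G (Suc 0)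
      then real (card (E (xs ! 1) (xs ! 0))) - real (card (E (xs ! 0) (xs ! 1))) else 0)" for xs
  have \<psi>: "\<psi> [u, v] = real (card (E v u)) - real (card (E u v))"
    if "u \<in> carrier G" "v \<in> carrier G" for u v
    using that unfolding \<psi>_def simplices_1 by simp
  have "\<psi> \<in> chains G S linear_growth (Suc 0)"
  proof -
    have "\<psi> (permute_list \<pi> xs) = of_int (sign \<pi>) * \<psi> xs"
      if xs: "xs \<in> simplices G (Suc 0)" and \<pi>: "\<pi> permutes {..<Suc (Suc 0)}" for xs \<pi>
    proof -
      obtain u v where uv: "u \<in> carrier G" "v \<in> carrier G" "xs = [u, v]"
        using xs by (auto simp: simplices_1)
      have "{..<Suc (Suc 0)} = {0, 1::nat}" by auto
      then have "\<pi> = id \<or> \<pi> = transpose 0 1"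
        using \<pi> permutes_doubleton_iff by metis
      then show ?thesis
        using uv \<psi> by (auto simp: permute_list_def sign_swap_id sign_id)
    qed
    moreover have "\<psi> xs = 0" if xs: "xs \<in> simplices G (Suc 0)" and far: "real (diagonal_dist G S xs) \<ge> 2" for xs
    proof -
      obtain u v where uv: "u \<in> carrier G" "v \<in> carrier G" "xs = [u, v]"
        using xs by (auto simp: simplices_1)
      then have "d u v \<ge> 2" "d v u \<ge> 2"
        using diagonal_dist_pair_le[of u v] far dist_commute[of u v] by auto
      then show ?thesis using uv E_far \<psi> by simp
    qed
    moreover have "\<bar>\<psi> xs\<bar> \<le> 2 * linear_growth (real (tuple_norm G S xs))"
      if xs: "xs \<in> simplices G (Suc 0)" for xs
    proof -
      obtain u v where uv: "u \<in> carrier G" "v \<in> carrier G" "xs = [u, v]"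
        using xs by (auto simp: simplices_1)
      have "real (d u \<one>) \<le> real (tuple_norm G S xs)" "real (d v \<one>) \<le> real (tuple_norm G S xs)"
        using uv by (simp_all add: tuple_norm_def)
      \<comment> \<open>Both counts are nonnegative, so their difference is bounded by the larger
        one and the constant stays \<open>2\<close>.\<close>
      then have "\<bar>real (card (E v u)) - real (card (E u v))\<bar> \<le> 2 * (1 + real (tuple_norm G S xs))"
        using cardE[OF uv(1), of v] cardE[OF uv(2), of u]
        by (smt (verit) of_nat_0_le_iff)
      then show ?thesis using \<psi> uv by (simp add: linear_growth_def)
    qed
    moreover have "\<psi> xs = 0" if "xs \<notin> simplices G (Suc 0)" for xs using that by (simp add: \<psi>_def)
    ultimately show ?thesis unfolding chains_def by blast
  qed
  moreover have "boundary G (Suc 0) \<psi> = (\<lambda>xs. if xs \<in> simplices G 0 then 1 else 0)"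
  proof
    fix ys
    show "boundary G (Suc 0) \<psi> ys = (if ys \<in> simplices G 0 then 1 else 0)"
    proof (cases "ys \<in> simplices G 0")
      case True
      then obtain y where y: "y \<in> carrier G" "ys = [y]" by (auto simp: simplices_0)
      define B where "B = {z \<in> carrier G. d y z \<le> 1}"
      have B: "finite B" unfolding B_def using finite_ball[OF assms(1) y(1)] .
      have near: "z \<in> B" if "z \<in> carrier G" "\<psi> [z, y] \<noteq> 0" for z
      proof (rule ccontr)
        assume "z \<notin> B"
        then have "E y z = {}" "E z y = {}"
          using that y dist_commute[of y z] by (auto simp: B_def intro!: E_far)
        then show False using that \<psi> y by simp
      qed
      have "boundary G (Suc 0) \<psi> ys = (\<Sum>z | z \<in> carrier G \<and> \<psi> [z, y] \<noteq> 0. \<psi> [z, y])"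
        using True y by (simp add: boundary_def)
      also have "\<dots> = (\<Sum>z\<in>B. \<psi> [z, y])"
        by (rule sum.mono_neutral_left[OF B]) (use near in \<open>auto simp: B_def\<close>)
      also have "\<dots> = (\<Sum>z\<in>B. real (card (E y z)) - real (card (E z y)))"
        using \<psi> y by (intro sum.cong) (auto simp: B_def)
      also have "\<dots> = real (\<Sum>z\<in>B. card (E y z)) - real (\<Sum>z\<in>B. card (E z y))"
        by (simp add: sum_subtractf)
      also have "(\<Sum>z\<in>B. card (E y z)) = card (\<Union>z\<in>B. E y z)"
        by (rule card_UN_disjoint[symmetric])
          (use B finE y E_disjoint in auto)
      \<comment> \<open>Rays never stop, so every passage through \<open>y\<close> leaves to a point
        of \<open>B\<close>.\<close>
      also have "(\<Union>z\<in>B. E y z) = T y"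
        using rs rc y by (fastforce simp: B_def E_def T_def)
      also have "(\<Sum>z\<in>B. card (E z y)) = card (\<Union>z\<in>B. E z y)"
        by (rule card_UN_disjoint[symmetric])
          (use B finE E_disjoint in \<open>auto simp: B_def\<close>)
      also have "(\<Union>z\<in>B. E z y) = {(x, k). x \<in> carrier G \<and> r x (Suc k) = y}" (is "_ = ?I")
        using rs rc y dist_commute by (fastforce simp: B_def E_def)
      also have "card (T y) = Suc (card ?I)"
      proof -
        \<comment> \<open>Every passage through \<open>y\<close> is an arrival at a positive time,
          shifted by one in \<open>?I\<close>, except the start of the ray of \<open>y\<close>. This
          single excess gives the value 1.\<close>
        have "T y = insert (y, 0) (map_prod id Suc ` ?I)"
        proof
          show "T y \<subseteq> insert (y, 0) (map_prod id Suc ` ?I)"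
          proof clarify
            fix x k assume "(x, k) \<in> T y" "(x, k) \<notin> map_prod id Suc ` ?I"
            then show "x = y \<and> k = 0"
              using r0 by (cases k) (force simp: T_def)+
          qed
        qed (use y r0 in \<open>auto simp: T_def\<close>)
        moreover have "(y, 0) \<notin> map_prod id Suc ` ?I" by auto
        moreover have "finite (map_prod id Suc ` ?I)"
          using finT[OF y(1)] by (rule finite_subset[rotated]) (auto simp: T_def)
        moreover have "card (map_prod id Suc ` ?I) = card ?I"
          by (rule card_image) (auto simp: inj_on_def)
        ultimately show ?thesis by simp
      qed
      finally show ?thesis using True by simp
    qed (simp add: boundary_def)
  qed
  ultimately show ?thesis unfolding boundaries_def by (simp add: image_iff) metis
qed

end

theorem theorem3p1:
  fixes G :: "('a, 'b) monoid_scheme" and S :: "'a set"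
  assumes "group G"
    and "infinite (carrier G)"
    and "finite S"
    and "symmetric_generating_set G S"
  shows "fundamental_class G S linear_growth = \<one>\<^bsub>homology G S linear_growth 0\<^esub>"
proof -
  interpret word_metric G S
    using assms by (simp add: word_metric_def word_metric_axioms_def)
  show ?thesis
    unfolding fundamental_class_def
    using homology_class_eq_one constant_one_boundary assms by blast
qed

end
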